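(* Let $\mathbf p\in\mathbb P(\mathcal X)$, $\alpha\in[0,1)$ and $t\in[0,\infty)$. The optimal real-valued prefix code length vector $\mathbf l^\dagger_{t,\alpha}$, minimizing $$\mathbb L_{t,\alpha}(\mathbf l,\mathbf p)=\frac{\alpha}{t}\log\Big(\sum_{x\in\mathcal X}p(x)D^{t\,l(x)}\Big)+(1-\alpha)\sum_{x\in\mathcal X}l(x)p(x)$$ over $\mathbf l\in\mathcal L(\mathbb R_+^{|\mathcal X|})$, is given (implicitly) by $$l^\dagger_{t,\alpha}(x)=-\log\big(\alpha\,\nu_{t,\alpha}(x)+(1-\alpha)p(x)\big),\qquad x\in\mathcal X,$$ where $\{\nu_{t,\alpha}(x):x\in\mathcal X\}$ is the tilted probability distribution $$\nu_{t,\alpha}(x)=\frac{D^{t\,l^\dagger_{t,\alpha}(x)}\,p(x)}{\sum_{y\in\mathcal X}p(y)D^{t\,l^\dagger_{t,\alpha}(y)}},\qquad x\in\mathcal X.$$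
   Context: Let $D\ge 2$ be an integer and $\log=\log_D$. Let $\mathcal X=\{x_1,\dots,x_{|\mathcal X|}\}$ be a finite alphabet and let $\mathbb P(\mathcal X)$ be the set of probability vectors $\mathbf p=(p(x_1),\dots,p(x_{|\mathcal X|}))$ with $p(x_1)\ge p(x_2)\ge\dots\ge p(x_{|\mathcal X|})>0$ and $\sum_x p(x)=1$. Real-valued prefix code length vectors are the elements of $\mathcal L(\mathbb R_+^{|\mathcal X|})=\{\mathbf l\in\mathbb R_+^{|\mathcal X|}:\sum_{x\in\mathcal X}D^{-l(x)}\le 1\}$, where $\mathbb R_+=[0,\infty)$. For $t=0$ the term $\frac1t\log\big(\sum_x p(x)D^{t\,l(x)}\big)$ is interpreted as its limit as $t\to0$, namely $\sum_x l(x)p(x)$. *)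

theory Defs
  imports "HOL-Analysis.Analysis"
begin

text \<open>
  The alphabet \<open>x\<^sub>1, \<dots>, x\<^sub>n\<close> is an arbitrary finite linearly ordered type, listed in increasing
  order, so a probability vector sorted in non-increasing order is antitone in its index.
\<close>

definition prob_vectors :: "(real ^ 'a::{finite,linorder}) set" where
  "prob_vectors = {p. antimono (($) p) \<and> (\<forall>x. p $ x > 0) \<and> (\<Sum>x\<in>UNIV. p $ x) = 1}"

definition prefix_code_lengths :: "nat \<Rightarrow> (real ^ 'a::finite) set" where
  "prefix_code_lengths D =
     {l. (\<forall>x. l $ x \<ge> 0) \<and> (\<Sum>x\<in>UNIV. real D powr (- (l $ x))) \<le> 1}"

definition mean_length :: "real ^ 'a::finite \<Rightarrow> real ^ 'a \<Rightarrow> real" where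
  "mean_length l p = (\<Sum>x\<in>UNIV. l $ x * p $ x)"

text \<open>The value at \<open>t = 0\<close> is the limit for \<open>t \<rightarrow> 0\<close>; see \<open>exp_mean_length_tendsto\<close> below.\<close>

definition exp_mean_length :: "nat \<Rightarrow> real \<Rightarrow> real ^ 'a::finite \<Rightarrow> real ^ 'a \<Rightarrow> real" where
  "exp_mean_length D t l p =
     (if t = 0 then mean_length l p
      else 1 / t * log (real D) (\<Sum>x\<in>UNIV. p $ x * real D powr (t * l $ x)))"

definition combined_length ::
    "nat \<Rightarrow> real \<Rightarrow> real \<Rightarrow> real ^ 'a::finite \<Rightarrow> real ^ 'a \<Rightarrow> real" where
  "combined_length D t \<alpha> l p = \<alpha> * exp_mean_length D t l p + (1 - \<alpha>) * mean_length l p"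

definition tilted :: "nat \<Rightarrow> real \<Rightarrow> real ^ 'a::finite \<Rightarrow> real ^ 'a \<Rightarrow> real ^ 'a" where
  "tilted D t l p =
     (\<chi> x. real D powr (t * l $ x) * p $ x / (\<Sum>y\<in>UNIV. p $ y * real D powr (t * l $ y)))"

definition optimal_lengths ::
    "nat \<Rightarrow> real \<Rightarrow> real \<Rightarrow> real ^ 'a::finite \<Rightarrow> real ^ 'a \<Rightarrow> bool" where
  "optimal_lengths D t \<alpha> p l \<longleftrightarrow>
     is_arg_min (\<lambda>l. combined_length D t \<alpha> l p) (\<lambda>l. l \<in> prefix_code_lengths D) l"

lemma exp_mean_length_tendsto:
  fixes p l :: "real ^ 'a::{finite,linorder}"
  assumes D: "D \<ge> 2" and p: "p \<in> prob_vectors"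
  shows "((\<lambda>t. 1 / t * log (real D) (\<Sum>x\<in>UNIV. p $ x * real D powr (t * l $ x)))
            \<longlongrightarrow> exp_mean_length D 0 l p) (at 0)"
proof -
  let ?S = "\<lambda>t. \<Sum>x\<in>UNIV. p $ x * real D powr (t * l $ x)"
  have S0: "?S 0 = 1" using D p by (simp add: prob_vectors_def)
  have lnD: "ln (real D) > 0" using D by simp
  have "(?S has_real_derivative (\<Sum>x\<in>UNIV. p $ x * (l $ x * ln (real D)))) (at 0)"
    using D by (auto intro!: derivative_eq_intros sum.cong)
  moreover have "?S 0 > 0" by (simp only: S0)
  ultimately have "((\<lambda>t. ln (?S t)) has_real_derivative
      1 / ?S 0 * (\<Sum>x\<in>UNIV. p $ x * (l $ x * ln (real D)))) (at 0)"
    by (intro DERIV_chain2[OF DERIV_ln_divide])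
  then have "((\<lambda>t. ln (?S t) / t) \<longlongrightarrow> (\<Sum>x\<in>UNIV. p $ x * (l $ x * ln (real D)))) (at 0)"
    unfolding has_field_derivative_iff S0 by simp
  then have "((\<lambda>t. ln (?S t) / t / ln (real D)) \<longlongrightarrow>
      (\<Sum>x\<in>UNIV. p $ x * (l $ x * ln (real D))) / ln (real D)) (at 0)"
    using lnD by (intro tendsto_divide) auto
  moreover have "(\<Sum>x\<in>UNIV. p $ x * (l $ x * ln (real D))) / ln (real D) = exp_mean_length D 0 l p"
    using lnD by (simp add: exp_mean_length_def mean_length_def sum_divide_distrib mult.commute)
  ultimately show ?thesis by (simp add: log_def mult.commute)
qed

lemma tilted_distribution:
  fixes p l :: "real ^ 'a::{finite,linorder}"
  assumes D: "D \<ge> 2" and p: "p \<in> prob_vectors"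
  shows "tilted D t l p $ x > 0" and "(\<Sum>x\<in>UNIV. tilted D t l p $ x) = 1"
proof -
  let ?S = "\<Sum>y\<in>UNIV. p $ y * real D powr (t * l $ y)"
  have S: "?S > 0" using D p by (intro sum_pos) (auto simp: prob_vectors_def)
  then show "tilted D t l p $ x > 0" using D p by (simp add: tilted_def prob_vectors_def)
  have "(\<Sum>x\<in>UNIV. tilted D t l p $ x) = ?S / ?S"
    unfolding tilted_def vec_lambda_beta sum_divide_distrib by (simp add: mult.commute)
  then show "(\<Sum>x\<in>UNIV. tilted D t l p $ x) = 1" using S by simp
qed

end

theory Submission
  imports Defs
begin

text \<open>
  The gradient of \<open>l \<mapsto> \<L>(l, p)\<close> at \<open>l\<close> is the distribution \<open>q\<^sub>l = \<alpha> \<nu>\<^sub>l + (1 - \<alpha>) p\<close>. If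
  \<open>l = - log q\<^sub>l\<close>, convexity gives \<open>\<L>(m, p) - \<L>(l, p) \<ge> \<Sum> q\<^sub>l (m - l)\<close>, which is the divergence of
  \<open>q\<^sub>l\<close> from \<open>D\<^sup>-\<^sup>m\<close> and hence strictly positive for every admissible \<open>m \<noteq> l\<close> by Gibbs' inequality. So
  a solution of the implicit equation is the unique minimizer, and only the existence of a solution
  remains. Since \<open>(1 - \<alpha>) p \<le> q\<^sub>l \<le> 1\<close>, the map \<open>l \<mapsto> - log q\<^sub>l\<close> sends a compact box into itself, so
  Brouwer's theorem provides one.
\<close>

text \<open>Weighting \<open>ln u \<le> u - 1\<close> at \<open>u = r x / q x\<close> by
  \<open>q x\<close> and summing bounds the difference of the two sides by
  \<open>sum r UNIV - sum q UNIV \<le> 0\<close>. Equality in the tangent bound forces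
  \<open>u = 1\<close>, so a point where \<open>q\<close> and \<open>r\<close> differ makes it
  strict.\<close>

lemma gibbs_inequality_strict:
  fixes q r :: "'a::finite \<Rightarrow> real"
  assumes q: "\<And>x. q x > 0" "sum q UNIV = 1" and r: "\<And>x. r x > 0" "sum r UNIV \<le> 1"
    and ne: "q \<noteq> r"
  shows "(\<Sum>x\<in>UNIV. q x * ln (r x)) < (\<Sum>x\<in>UNIV. q x * ln (q x))"
proof -
  have le: "q x * ln (r x) - q x * ln (q x) \<le> r x - q x" for x
  proof -
    have "q x * ln (r x / q x) \<le> q x * (r x / q x - 1)"
      using q(1)[of x] r(1)[of x] by (intro mult_left_mono ln_le_minus_one) auto
    then show ?thesis using q(1)[of x] r(1)[of x] by (simp add: ln_div algebra_simps)
  qed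
  obtain z where z: "q z \<noteq> r z" using ne by auto
  have "ln (r z / q z) \<noteq> r z / q z - 1"
    using ln_eq_minus_one[of "r z / q z"] q(1)[of z] r(1)[of z] z by auto
  then have "q z * ln (r z) - q z * ln (q z) \<noteq> r z - q z"
    using q(1)[of z] r(1)[of z] by (simp add: ln_div field_simps)
  then have "(\<Sum>x\<in>UNIV. q x * ln (r x) - q x * ln (q x)) < (\<Sum>x\<in>UNIV. r x - q x)"
    using le order_le_neq_trans[OF le] by (intro sum_strict_mono_ex1) auto
  then show ?thesis using q(2) r(2) by (simp add: sum_subtractf)
qed

text \<open>The tangent of \<open>exp\<close> at the mean \<open>c\<close> lies below
  \<open>exp\<close>. Since the deviations \<open>y x - c\<close> average to zero under
  \<open>\<nu>\<close>, the tangent averages to exactly \<open>exp c\<close>.\<close>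

lemma jensen_exp:
  fixes \<nu> y :: "'a::finite \<Rightarrow> real"
  assumes "\<And>x. \<nu> x > 0" "sum \<nu> UNIV = 1"
  shows "(\<Sum>x\<in>UNIV. \<nu> x * y x) \<le> ln (\<Sum>x\<in>UNIV. \<nu> x * exp (y x))"
proof -
  define c where "c = (\<Sum>x\<in>UNIV. \<nu> x * y x)"
  have tangent: "exp c * (1 + (y x - c)) \<le> exp (y x)" for x
    using mult_left_mono[OF exp_ge_add_one_self[of "y x - c"], of "exp c"]
    by (simp flip: exp_add)
  have "(\<Sum>x\<in>UNIV. \<nu> x * (1 + (y x - c))) = (1 - c) * sum \<nu> UNIV + c"
    by (simp add: c_def[symmetric] algebra_simps sum.distrib sum_subtractf flip: sum_distrib_left)
  then have "exp c = exp c * (\<Sum>x\<in>UNIV. \<nu> x * (1 + (y x - c)))"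
    using assms(2) by simp
  also have "\<dots> = (\<Sum>x\<in>UNIV. \<nu> x * (exp c * (1 + (y x - c))))"
    by (simp add: sum_distrib_left mult.left_commute)
  also have "\<dots> \<le> (\<Sum>x\<in>UNIV. \<nu> x * exp (y x))"
    using assms(1) tangent by (intro sum_mono mult_left_mono) (auto intro: less_imp_le)
  finally have "exp c \<le> (\<Sum>x\<in>UNIV. \<nu> x * exp (y x))" .
  then show ?thesis
    unfolding c_def by (subst ln_ge_iff) (auto intro: less_le_trans[OF exp_gt_zero])
qed

lemma mean_length_diff:
  "mean_length m p - mean_length l p = (\<Sum>x\<in>UNIV. p $ x * (m $ x - l $ x))"
  by (simp add: mean_length_def sum_subtractf algebra_simps)

lemma exp_mean_length_subgradient:
  fixes p l m :: "real ^ 'a::{finite,linorder}"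
  assumes D: "D \<ge> 2" and p: "p \<in> prob_vectors" and t: "t \<ge> 0"
  shows "(\<Sum>x\<in>UNIV. tilted D t l p $ x * (m $ x - l $ x))
           \<le> exp_mean_length D t m p - exp_mean_length D t l p"
proof (cases "t = 0")
  case True
  \<comment> \<open>All tilting weights are 1 here and the functional is linear, so the inequality
    is an equality.\<close>
  then have "tilted D t l p = p"
    using D p by (simp add: tilted_def prob_vectors_def vec_eq_iff)
  then show ?thesis using True by (simp add: exp_mean_length_def mean_length_diff)
next
  case False
  let ?S = "\<lambda>l. \<Sum>y\<in>UNIV. p $ y * real D powr (t * l $ y)"
  let ?y = "\<lambda>x. t * ln D * (m $ x - l $ x)"
  have S: "?S l > 0" for l
    using D p by (intro sum_pos) (auto simp: prob_vectors_def)
  have lnD: "ln (real D) > 0" using D by simp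
  \<comment> \<open>Change of measure: the ratio \<open>?S m / ?S l\<close> is the mean of
    \<open>exp (?y x)\<close> under the distribution tilted by \<open>l\<close>, so Jensen bounds
    its logarithm from below by a linear form in \<open>m - l\<close>.\<close>
  have "tilted D t l p $ x * exp (?y x) = p $ x * real D powr (t * m $ x) / ?S l" for x
    using D by (simp add: tilted_def powr_def algebra_simps flip: exp_add)
  then have "(\<Sum>x\<in>UNIV. tilted D t l p $ x * exp (?y x)) = ?S m / ?S l"
    by (simp add: sum_divide_distrib)
  then have "(\<Sum>x\<in>UNIV. tilted D t l p $ x * ?y x) \<le> ln (?S m) - ln (?S l)"
    using jensen_exp[of "\<lambda>x. tilted D t l p $ x" ?y] tilted_distribution[OF D p, of t l]
      S[of m] S[of l] by (simp add: ln_div)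
  moreover have "(\<Sum>x\<in>UNIV. tilted D t l p $ x * ?y x) =
      t * ln D * (\<Sum>x\<in>UNIV. tilted D t l p $ x * (m $ x - l $ x))"
    by (simp add: sum_distrib_left mult.left_commute)
  ultimately have "(\<Sum>x\<in>UNIV. tilted D t l p $ x * (m $ x - l $ x))
      \<le> (ln (?S m) - ln (?S l)) / (t * ln D)"
    using lnD t False by (simp add: pos_le_divide_eq mult.commute)
  then show ?thesis
    using False by (simp add: exp_mean_length_def log_def diff_divide_distrib mult.commute)
qed

definition mixture :: "nat \<Rightarrow> real \<Rightarrow> real \<Rightarrow> real ^ 'a::finite \<Rightarrow> real ^ 'a \<Rightarrow> 'a \<Rightarrow> real" where
  "mixture D t \<alpha> l p x = \<alpha> * tilted D t l p $ x + (1 - \<alpha>) * p $ x"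

text \<open>The lower bound does not depend on \<open>l\<close>. Together with the upper bound 1 it
  confines \<open>- log D (mixture D t \<alpha> l p x)\<close> to a fixed interval.\<close>

lemma
  fixes p l :: "real ^ 'a::{finite,linorder}"
  assumes D: "D \<ge> 2" and p: "p \<in> prob_vectors" and \<alpha>: "\<alpha> \<in> {0..<1}"
  shows mixture_ge: "(1 - \<alpha>) * p $ x \<le> mixture D t \<alpha> l p x"
    and mixture_pos: "mixture D t \<alpha> l p x > 0"
    and sum_mixture: "(\<Sum>x\<in>UNIV. mixture D t \<alpha> l p x) = 1"
    and mixture_le_one: "mixture D t \<alpha> l p x \<le> 1"
proof -
  have p_pos: "p $ x > 0" for x
    using p by (simp add: prob_vectors_def)
  have p_sum: "(\<Sum>x\<in>UNIV. p $ x) = 1"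
    using p by (simp add: prob_vectors_def)
  note \<nu> = tilted_distribution[OF D p, of t l]
  show ge: "(1 - \<alpha>) * p $ x \<le> mixture D t \<alpha> l p x" for x
    using \<nu>(1)[of x] \<alpha> by (simp add: mixture_def)
  show pos: "mixture D t \<alpha> l p x > 0" for x
    using ge[of x] p_pos[of x] \<alpha> by (auto intro: less_le_trans[rotated])
  show sum: "(\<Sum>x\<in>UNIV. mixture D t \<alpha> l p x) = 1"
    using \<nu>(2) p_sum by (simp add: mixture_def sum.distrib flip: sum_distrib_left)
  show "mixture D t \<alpha> l p x \<le> 1"
    using member_le_sum[of x UNIV "mixture D t \<alpha> l p"] pos sum by (simp add: less_imp_le)
qed

lemma combined_length_subgradient:
  fixes p l m :: "real ^ 'a::{finite,linorder}"
  assumes D: "D \<ge> 2" and p: "p \<in> prob_vectors" and \<alpha>: "\<alpha> \<ge> 0" and t: "t \<ge> 0"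
  shows "(\<Sum>x\<in>UNIV. mixture D t \<alpha> l p x * (m $ x - l $ x))
           \<le> combined_length D t \<alpha> m p - combined_length D t \<alpha> l p"
proof -
  have "(\<Sum>x\<in>UNIV. mixture D t \<alpha> l p x * (m $ x - l $ x)) =
      \<alpha> * (\<Sum>x\<in>UNIV. tilted D t l p $ x * (m $ x - l $ x)) +
      (1 - \<alpha>) * (mean_length m p - mean_length l p)"
    by (simp add: mixture_def mean_length_diff distrib_right sum.distrib sum_distrib_left
        mult.assoc)
  also have "\<dots> \<le> \<alpha> * (exp_mean_length D t m p - exp_mean_length D t l p) +
      (1 - \<alpha>) * (mean_length m p - mean_length l p)"
    using exp_mean_length_subgradient[OF D p t] \<alpha> by (simp add: mult_left_mono)
  finally show ?thesis by (simp add: combined_length_def algebra_simps)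
qed

lemma fixed_point_strict_minimum:
  fixes p l m :: "real ^ 'a::{finite,linorder}"
  assumes D: "D \<ge> 2" and p: "p \<in> prob_vectors" and \<alpha>: "\<alpha> \<in> {0..<1}" and t: "t \<ge> 0"
    and l: "\<And>x. l $ x = - log D (mixture D t \<alpha> l p x)"
    and m: "m \<in> prefix_code_lengths D" and ne: "m \<noteq> l"
  shows "combined_length D t \<alpha> l p < combined_length D t \<alpha> m p"
proof -
  let ?q = "mixture D t \<alpha> l p" and ?r = "\<lambda>x. real D powr - (m $ x)"
  have lnD: "ln (real D) > 0" using D by simp
  \<comment> \<open>The fixed point equation makes \<open>ln (?q x)\<close> linear in
    \<open>l\<close>, so the gap in Gibbs' inequality becomes \<open>ln D\<close> times the linear
    form of the subgradient inequality.\<close>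
  have ln_q: "ln (?q x) = - (l $ x * ln D)" for x
    using l[of x] lnD by (simp add: log_def)
  have ln_r: "ln (?r x) = - (m $ x * ln D)" for x
    using D by (simp add: ln_powr)
  have "?q \<noteq> ?r"
  proof
    assume "?q = ?r"
    then have "l $ x * ln D = m $ x * ln D" for x by (metis ln_q ln_r neg_equal_iff_equal)
    then have "l $ x = m $ x" for x using lnD by simp
    then show False using ne by (simp add: vec_eq_iff)
  qed
  then have "(\<Sum>x\<in>UNIV. ?q x * ln (?r x)) < (\<Sum>x\<in>UNIV. ?q x * ln (?q x))"
    using mixture_pos[OF D p \<alpha>] sum_mixture[OF D p \<alpha>] m D
    by (intro gibbs_inequality_strict) (auto simp: prefix_code_lengths_def)
  then have "0 < ln D * (\<Sum>x\<in>UNIV. ?q x * (m $ x - l $ x))"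
    by (simp add: ln_q ln_r sum_negf sum_distrib_left algebra_simps sum_subtractf)
  then have "0 < (\<Sum>x\<in>UNIV. ?q x * (m $ x - l $ x))"
    using lnD by (simp add: zero_less_mult_iff)
  also have "\<dots> \<le> combined_length D t \<alpha> m p - combined_length D t \<alpha> l p"
    using combined_length_subgradient[OF D p _ t] \<alpha> by simp
  finally show ?thesis by simp
qed

lemma fixed_point_exists:
  fixes p :: "real ^ 'a::{finite,linorder}"
  assumes D: "D \<ge> 2" and p: "p \<in> prob_vectors" and \<alpha>: "\<alpha> \<in> {0..<1}"
  obtains l where "l \<in> prefix_code_lengths D" "\<And>x. l $ x = - log D (mixture D t \<alpha> l p x)"
proof -
  let ?f = "\<lambda>l. \<chi> x. - log D (mixture D t \<alpha> l p x)"
  \<comment> \<open>The upper corner comes from \<open>mixture_ge\<close>; its logarithms have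
    positive arguments because \<open>\<alpha> < 1\<close> and \<open>p $ x > 0\<close>.\<close>
  let ?B = "cbox 0 (\<chi> x. - log D ((1 - \<alpha>) * p $ x))"
  have D1: "real D > 1" using D by simp
  note pos = mixture_pos[OF D p \<alpha>] and le_one = mixture_le_one[OF D p \<alpha>]
  have low: "(1 - \<alpha>) * p $ x > 0" for x
    using p \<alpha> by (auto simp: prob_vectors_def)
  have bounds: "0 \<le> - log D (mixture D t \<alpha> l p x)"
      "- log D (mixture D t \<alpha> l p x) \<le> - log D ((1 - \<alpha>) * p $ x)" for l x
    using D1 pos[of t l x] le_one[of t l x] low[of x] mixture_ge[OF D p \<alpha>, of x t l]
    by auto
  then have maps: "?f ` ?B \<subseteq> ?B"
    by (auto simp: mem_box_cart)
  have "0 \<le> - log D ((1 - \<alpha>) * p $ x)" for x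
    using bounds[of 0 x] by linarith
  then have "?B \<noteq> {}"
    by (simp add: interval_ne_empty_cart)
  moreover have "continuous_on ?B ?f"
  proof (rule continuous_on_vec_lambda)
    fix x
    have S: "(\<Sum>y\<in>UNIV. p $ y * real D powr (t * l $ y)) \<noteq> 0" for l
      using D p by (intro less_imp_neq[symmetric] sum_pos) (auto simp: prob_vectors_def)
    have "continuous_on ?B (\<lambda>l. mixture D t \<alpha> l p x)"
      unfolding mixture_def tilted_def using S D1 by (auto intro!: continuous_intros)
    then show "continuous_on ?B (\<lambda>l. - log D (mixture D t \<alpha> l p x))"
      unfolding log_def using D1 pos
      by (intro continuous_intros) (auto simp: less_imp_neq[symmetric])
  qed
  ultimately obtain l where "?f l = l"
    using brouwer[of ?B ?f] maps by auto
  then have l: "l $ x = - log D (mixture D t \<alpha> l p x)" for x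
    by (metis vec_lambda_beta)
  \<comment> \<open>A fixed point meets Kraft's inequality with equality, since its terms are the
    entries of a distribution.\<close>
  then have "real D powr - (l $ x) = mixture D t \<alpha> l p x" for x
    using D1 pos[of t l x] by simp
  then have "l \<in> prefix_code_lengths D"
    using bounds(1)[of l] sum_mixture[OF D p \<alpha>, of t l] l by (simp add: prefix_code_lengths_def)
  then show ?thesis using l that by blast
qed

theorem theorem5:
  fixes D :: nat and t \<alpha> :: real and p :: "real ^ 'a::{finite,linorder}"
  assumes "D \<ge> 2" and "p \<in> prob_vectors" and "\<alpha> \<in> {0..<1}" and "t \<in> {0..}"
  shows "(\<exists>!l. optimal_lengths D t \<alpha> p l) \<and>
         (\<forall>l \<in> prefix_code_lengths D. optimal_lengths D t \<alpha> p l \<longleftrightarrow>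
           (\<forall>x. l $ x = - log (real D) (\<alpha> * tilted D t l p $ x + (1 - \<alpha>) * p $ x)))"
proof -
  let ?fixed = "\<lambda>l. \<forall>x. l $ x = - log D (mixture D t \<alpha> l p x)"
  obtain k where k: "k \<in> prefix_code_lengths D" "?fixed k"
    using fixed_point_exists[OF assms(1-3)] by metis
  have less: "combined_length D t \<alpha> l p < combined_length D t \<alpha> m p"
    if "?fixed l" "m \<in> prefix_code_lengths D" "m \<noteq> l" for l m
    using fixed_point_strict_minimum[OF assms(1-3)] assms(4) that by auto
  \<comment> \<open>As \<open>k\<close> strictly beats every other admissible vector, it is a
    minimizer and no other vector can be one.\<close>
  have optimal_iff: "optimal_lengths D t \<alpha> p l \<longleftrightarrow> l = k" for l
    unfolding optimal_lengths_def is_arg_min_def using k less[of k] by (metis less_asym)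
  \<comment> \<open>Two distinct admissible fixed points would each be strictly better than the
    other.\<close>
  have "?fixed l \<longleftrightarrow> l = k" if "l \<in> prefix_code_lengths D" for l
    using k less[OF k(2) that] less[of l k] by (metis less_asym)
  then show ?thesis
    using optimal_iff by (simp add: mixture_def)
qed

end
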